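(* The collection $\mathcal{C}$ of all conjunctions of atoms of the form $x=\{y\}$ is $\mathcal{O}(n^2)$-expressible from $\mathbb{BST}$ into $\mathbb{BST}^{+}$. That is, there is a map $\langle\varphi(\vec y),\psi(\vec x)\rangle\mapsto \Xi^\psi_\varphi(\vec x,\vec y,\vec z)$ from pairs consisting of a $\mathbb{BST}$-conjunction $\varphi$ and a $\psi\in\mathcal{C}$ into $\mathbb{BST}^{+}$, with no variable of $\vec z$ occurring in $\vec x$ or $\vec y$, such that: (a) the map is computable in time $\mathcal{O}(|\varphi\wedge\psi|^2)$, where $|\varphi\wedge\psi|$ is the length of $\varphi\wedge\psi$; (b) if $\varphi(\vec y)\wedge\Xi^\psi_\varphi(\vec x,\vec y,\vec z)$ is satisfiable, so is $\varphi(\vec y)\wedge\psi(\vec x)$; (c) $\models (\varphi(\vec y)\wedge\psi(\vec x))\to(\exists\vec z)\,\Xi^\psi_\varphi(\vec x,\vec y,\vec z)$.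
   Context: Set variables range over the von Neumann universe of well-founded sets; a set assignment maps variables to well-founded sets, satisfiability means existence of a satisfying set assignment, and $\models$ means truth under every set assignment. $\mathbb{BST}$ is the collection of conjunctions of literals $x=y\setminus z$ and $x\neq y\setminus z$ (ordinary set difference). $\mathbb{BST}^{+}$ is the collection of propositional combinations of atoms $x=y\setminus z$; literals such as $x=\emptyset$, $x\subseteq y$, $x\subsetneq y$, $x\cap y=\emptyset$ and their negations are used within $\mathbb{BST}^+$-formulae as in the paper. *)

theory Defs
  imports Complex_Main "HOL-Library.Landau_Symbols" "HOL-Library.Nat_Bijection"
begin

section \<open>Universes of well-founded sets\<close>

text \<open>
  HOL has no type that is provably the von Neumann universe, so universes are described
  axiomatically: \<open>elts x\<close> is the collection of members of the set \<open>x\<close>, and a collection is a set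
  iff it lies in \<^term>\<open>range elts\<close>.  The assumptions are the second-order ZF axioms, pairing and
  the empty set being derivable.  The axiom of infinity is the only one left out, so that both
  the full von Neumann universe and the hereditarily finite sets are instances; the latter shows
  that the assumptions are consistent in plain HOL.
\<close>

locale set_universe =
  fixes elts :: "'v \<Rightarrow> 'v set"
  assumes extensionality: "elts x = elts y \<Longrightarrow> x = y"
    and foundation: "wf {(x, y). x \<in> elts y}"
    and separation: "Y \<subseteq> elts x \<Longrightarrow> Y \<in> range elts"
    and union: "\<Union> (elts ` elts x) \<in> range elts"
    and powerset: "{y. elts y \<subseteq> elts x} \<in> range elts"
    and replacement: "f ` elts x \<in> range elts"

lemma set_universe_hereditarily_finite: "set_universe set_decode"
proof -
  have rng: "A \<in> range set_decode" if "finite A" for A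
    using that by (metis rangeI set_encode_inverse)
  have less: "x < y" if "x \<in> set_decode y" for x y
  proof -
    have "y div 2 ^ x \<noteq> 0"
      using that by (intro notI) (simp add: set_decode_def)
    then have "2 ^ x \<le> y"
      by (simp add: div_eq_0_iff)
    then show ?thesis
      using less_exp[of x] by (rule less_le_trans[rotated])
  qed
  show ?thesis
  proof
    show "x = y" if "set_decode x = set_decode y" for x y
      using that by (metis set_decode_inverse)
    show "wf {(x, y). x \<in> set_decode y}"
      by (rule wf_subset[OF wf_less]) (auto dest: less)
    show "Y \<in> range set_decode" if "Y \<subseteq> set_decode x" for Y x
      using that by (intro rng) (rule finite_subset, auto)
    show "\<Union> (set_decode ` set_decode x) \<in> range set_decode" for x
      by (rule rng) auto
    show "{y. set_decode y \<subseteq> set_decode x} \<in> range set_decode" for x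
    proof (rule rng, rule finite_imageD)
      show "finite (set_decode ` {y. set_decode y \<subseteq> set_decode x})"
        by (rule finite_subset[of _ "Pow (set_decode x)"]) auto
      show "inj_on set_decode {y. set_decode y \<subseteq> set_decode x}"
        by (metis inj_on_inverseI set_decode_inverse)
    qed
    show "f ` set_decode x \<in> range set_decode" for f x
      by (rule rng) simp
  qed
qed


section \<open>Formulae\<close>

type_synonym var = nat

text \<open>\<open>DiffEq x y z\<close> stands for $x = y \setminus z$ and \<open>SingEq x y\<close> for $x = \{y\}$.\<close>

datatype fm =
    DiffEq var var var
  | SingEq var var
  | Neg fm
  | Conj fm fm
  | Disj fm fm
  | Imp fm fm
  | Iff fm fm

primrec vars :: "fm \<Rightarrow> var set" where
  "vars (DiffEq x y z) = {x, y, z}"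
| "vars (SingEq x y) = {x, y}"
| "vars (Neg p) = vars p"
| "vars (Conj p q) = vars p \<union> vars q"
| "vars (Disj p q) = vars p \<union> vars q"
| "vars (Imp p q) = vars p \<union> vars q"
| "vars (Iff p q) = vars p \<union> vars q"

primrec sat :: "('v \<Rightarrow> 'v set) \<Rightarrow> (var \<Rightarrow> 'v) \<Rightarrow> fm \<Rightarrow> bool" where
  "sat elts M (DiffEq x y z) \<longleftrightarrow> elts (M x) = elts (M y) - elts (M z)"
| "sat elts M (SingEq x y) \<longleftrightarrow> elts (M x) = {M y}"
| "sat elts M (Neg p) \<longleftrightarrow> \<not> sat elts M p"
| "sat elts M (Conj p q) \<longleftrightarrow> sat elts M p \<and> sat elts M q"
| "sat elts M (Disj p q) \<longleftrightarrow> sat elts M p \<or> sat elts M q"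
| "sat elts M (Imp p q) \<longleftrightarrow> (sat elts M p \<longrightarrow> sat elts M q)"
| "sat elts M (Iff p q) \<longleftrightarrow> (sat elts M p \<longleftrightarrow> sat elts M q)"

definition sat_ex :: "('v \<Rightarrow> 'v set) \<Rightarrow> (var \<Rightarrow> 'v) \<Rightarrow> var set \<Rightarrow> fm \<Rightarrow> bool" where
  "sat_ex elts M Z p \<longleftrightarrow> (\<exists>M'. (\<forall>v. v \<notin> Z \<longrightarrow> M' v = M v) \<and> sat elts M' p)"

definition satisfiable :: "('v \<Rightarrow> 'v set) \<Rightarrow> fm \<Rightarrow> bool" where
  "satisfiable elts p \<longleftrightarrow> (\<exists>M. sat elts M p)"

inductive_set BST :: "fm set" where
  "DiffEq x y z \<in> BST"
| "Neg (DiffEq x y z) \<in> BST"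
| "p \<in> BST \<Longrightarrow> q \<in> BST \<Longrightarrow> Conj p q \<in> BST"

inductive_set singleton_conjs :: "fm set" where
  "SingEq x y \<in> singleton_conjs"
| "p \<in> singleton_conjs \<Longrightarrow> q \<in> singleton_conjs \<Longrightarrow> Conj p q \<in> singleton_conjs"

inductive_set BST_plus :: "fm set" where
  "DiffEq x y z \<in> BST_plus"
| "p \<in> BST_plus \<Longrightarrow> Neg p \<in> BST_plus"
| "p \<in> BST_plus \<Longrightarrow> q \<in> BST_plus \<Longrightarrow> Conj p q \<in> BST_plus"
| "p \<in> BST_plus \<Longrightarrow> q \<in> BST_plus \<Longrightarrow> Disj p q \<in> BST_plus"
| "p \<in> BST_plus \<Longrightarrow> q \<in> BST_plus \<Longrightarrow> Imp p q \<in> BST_plus"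
| "p \<in> BST_plus \<Longrightarrow> q \<in> BST_plus \<Longrightarrow> Iff p q \<in> BST_plus"

text \<open>
  Formulae are written as words in Polish notation.  Every occurrence of a variable is a single
  symbol, and \<open>0\<close> is not the code of a symbol.
\<close>

primrec encode :: "fm \<Rightarrow> nat list" where
  "encode (DiffEq x y z) = [1, x + 8, y + 8, z + 8]"
| "encode (SingEq x y) = [2, x + 8, y + 8]"
| "encode (Neg p) = 3 # encode p"
| "encode (Conj p q) = 4 # encode p @ encode q"
| "encode (Disj p q) = 5 # encode p @ encode q"
| "encode (Imp p q) = 6 # encode p @ encode q"
| "encode (Iff p q) = 7 # encode p @ encode q"

definition fm_length :: "fm \<Rightarrow> nat" where
  "fm_length p = length (encode p)"

lemma encode_append_inject: "encode p @ u = encode q @ v \<Longrightarrow> p = q \<and> u = v"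
proof (induction p arbitrary: q u v)
  case (DiffEq x y z)
  then show ?case by (cases q) auto
next
  case (SingEq x y)
  then show ?case by (cases q) auto
next
  case (Neg p)
  then show ?case by (cases q) auto
next
  case (Conj p1 p2)
  from Conj.prems obtain q1 q2 where q: "q = Conj q1 q2"
    and eq: "encode p1 @ (encode p2 @ u) = encode q1 @ (encode q2 @ v)"
    by (cases q) simp_all
  show ?case
    using Conj.IH(1)[OF eq] Conj.IH(2)[of u q2 v] q by simp
next
  case (Disj p1 p2)
  from Disj.prems obtain q1 q2 where q: "q = Disj q1 q2"
    and eq: "encode p1 @ (encode p2 @ u) = encode q1 @ (encode q2 @ v)"
    by (cases q) simp_all
  show ?case
    using Disj.IH(1)[OF eq] Disj.IH(2)[of u q2 v] q by simp
next
  case (Imp p1 p2)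
  from Imp.prems obtain q1 q2 where q: "q = Imp q1 q2"
    and eq: "encode p1 @ (encode p2 @ u) = encode q1 @ (encode q2 @ v)"
    by (cases q) simp_all
  show ?case
    using Imp.IH(1)[OF eq] Imp.IH(2)[of u q2 v] q by simp
next
  case (Iff p1 p2)
  from Iff.prems obtain q1 q2 where q: "q = Iff q1 q2"
    and eq: "encode p1 @ (encode p2 @ u) = encode q1 @ (encode q2 @ v)"
    by (cases q) simp_all
  show ?case
    using Iff.IH(1)[OF eq] Iff.IH(2)[of u q2 v] q by simp
qed

lemma inj_encode: "inj encode"
  using encode_append_inject[of _ "[]" _ "[]"] by (auto intro: injI)


section \<open>Random access machines\<close>

text \<open>
  Random access machines with addition, truncated subtraction and indirect addressing, a
  read-only input tape and a write-only output tape, under the uniform cost criterion: each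
  executed instruction counts as one step.  Reading past the end of the input yields \<open>0\<close>.  A
  configuration consists of the program counter, the memory, the remaining input and the output
  written so far; the machine halts when the program counter leaves the program.
\<close>

datatype instr =
    Const nat nat
  | Add nat nat nat
  | Sub nat nat nat
  | Load nat nat
  | Store nat nat
  | Read nat
  | Print nat
  | Jump nat
  | JumpIfZero nat nat

type_synonym config = "nat \<times> (nat \<Rightarrow> nat) \<times> nat list \<times> nat list"

fun exec :: "instr \<Rightarrow> config \<Rightarrow> config" where
  "exec (Const i c) (pc, m, inp, out) = (Suc pc, m(i := c), inp, out)"
| "exec (Add i j k) (pc, m, inp, out) = (Suc pc, m(i := m j + m k), inp, out)"
| "exec (Sub i j k) (pc, m, inp, out) = (Suc pc, m(i := m j - m k), inp, out)"
| "exec (Load i j) (pc, m, inp, out) = (Suc pc, m(i := m (m j)), inp, out)"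
| "exec (Store i j) (pc, m, inp, out) = (Suc pc, m(m i := m j), inp, out)"
| "exec (Read i) (pc, m, inp, out) =
     (Suc pc, m(i := (case inp of [] \<Rightarrow> 0 | a # _ \<Rightarrow> a)), tl inp, out)"
| "exec (Print i) (pc, m, inp, out) = (Suc pc, m, inp, out @ [m i])"
| "exec (Jump l) (pc, m, inp, out) = (l, m, inp, out)"
| "exec (JumpIfZero i l) (pc, m, inp, out) = (if m i = 0 then l else Suc pc, m, inp, out)"

definition step :: "instr list \<Rightarrow> config \<Rightarrow> config" where
  "step P c = (if fst c < length P then exec (P ! fst c) c else c)"

definition ram_computes_within :: "instr list \<Rightarrow> nat list \<Rightarrow> nat list \<Rightarrow> nat \<Rightarrow> bool" where
  "ram_computes_within P inp out t \<longleftrightarrow>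
     (\<exists>pc m inp'. length P \<le> pc \<and> (step P ^^ t) (0, \<lambda>_. 0, inp, []) = (pc, m, inp', out))"

text \<open>The word of \<open>Conj p q\<close> determines the pair \<open>(p, q)\<close> and serves as the input.\<close>

definition computable_in_time_O ::
  "(nat \<Rightarrow> real) \<Rightarrow> fm set \<Rightarrow> fm set \<Rightarrow> (fm \<Rightarrow> fm \<Rightarrow> fm) \<Rightarrow> bool" where
  "computable_in_time_O f A B \<Xi> \<longleftrightarrow>
     (\<exists>P T. (\<lambda>n. real (T n)) \<in> O(f) \<and>
       (\<forall>p\<in>A. \<forall>q\<in>B.
          ram_computes_within P (encode (Conj p q)) (encode (\<Xi> p q)) (T (fm_length (Conj p q)))))"

end

theory Submission
  imports Defs
begin

text \<open>
  For the conjuncts \<open>x\<^sub>i = {y\<^sub>i}\<close> of \<open>\<psi>\<close>, the formula \<open>\<Xi>\<close> says that every \<open>x\<^sub>i\<close> is nonempty and, for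
  each variable \<open>v\<close>, either included in \<open>v\<close> or disjoint from it; that \<open>x\<^sub>i = x\<^sub>j\<close> iff \<open>y\<^sub>i = y\<^sub>j\<close>; and
  that \<open>x\<^sub>i \<subseteq> y\<^sub>j\<close> implies \<open>z\<^sub>i \<subset> z\<^sub>j\<close> for new variables \<open>z\<^sub>i\<close>.  By the last condition the relation
  \<open>x\<^sub>i \<subseteq> y\<^sub>j\<close>, which must become \<open>y\<^sub>i \<in> y\<^sub>j\<close>, is well-founded.  Hence the elements of the regions of
  the Venn diagram of a model can be replaced recursively, one for each region, so that the
  element of the region \<open>x\<^sub>i\<close> is the new value of \<open>y\<^sub>i\<close>.  Literals of \<open>\<phi>\<close> only depend on which
  regions are nonempty.  The conjuncts of \<open>\<Xi>\<close> are indexed by pairs of symbols of the input, so two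
  nested scans of the input print them in quadratic time.
\<close>

section \<open>Replacing the elements of a Venn diagram\<close>

context set_universe
begin

section \<open>Finite sets inside a universe\<close>

definition mk :: "'v set \<Rightarrow> 'v" where
  "mk A = inv elts A"

lemma elts_mk: "A \<in> range elts \<Longrightarrow> elts (mk A) = A"
  unfolding mk_def by (rule f_inv_into_f)

lemma empty_in_range_elts: "{} \<in> range elts"
  using separation[of "{}"] by simp

text \<open>The double power set of the empty set has the two distinct members \<open>z\<close> and
  \<open>u\<close>. Sending \<open>z\<close> to \<open>a\<close> and everything else to
  \<open>b\<close> gives a set containing both.\<close>

lemma pair_in_range_elts: "{a, b} \<in> range elts"
proof -
  obtain z where z: "elts z = {}"
    using empty_in_range_elts by (metis imageE)
  obtain u where u: "elts u = {y. elts y \<subseteq> elts z}"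
    using powerset by (metis imageE)
  obtain w where w: "elts w = {y. elts y \<subseteq> elts u}"
    using powerset by (metis imageE)
  have "z \<in> elts w" "u \<in> elts w" "z \<noteq> u"
    using z u w by auto
  then have "{a, b} \<subseteq> (\<lambda>y. if y = z then a else b) ` elts w"
    by force
  moreover have "(\<lambda>y. if y = z then a else b) ` elts w \<in> range elts"
    by (rule replacement)
  ultimately show ?thesis
    by (metis imageE separation)
qed

lemma finite_in_range_elts: "finite A \<Longrightarrow> A \<in> range elts"
proof (induction A rule: finite_induct)
  case empty
  show ?case by (rule empty_in_range_elts)
next
  case (insert a A)
  obtain u v w where "elts u = A" "elts v = {a}" "elts w = {u, v}"
    using insert.IH pair_in_range_elts[of a a] pair_in_range_elts by (metis imageE insert_absorb2)
  then have "\<Union> (elts ` elts w) = insert a A"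
    by auto
  then show ?case
    using union[of w] by simp
qed

lemma elts_mk_finite: "finite A \<Longrightarrow> elts (mk A) = A"
  by (simp add: elts_mk finite_in_range_elts)

text \<open>Every finite collection is a set, so a finite universe would be a member of itself,
  against foundation.\<close>

lemma infinite_universe: "infinite (UNIV :: 'v set)"
proof
  assume "finite (UNIV :: 'v set)"
  then have "(mk UNIV, mk UNIV) \<in> {(x, y). x \<in> elts y}"
    by (simp add: elts_mk_finite)
  then show False
    using wf_not_refl[OF foundation] by blast
qed

text \<open>Sets of different cardinalities are different, so injectivity comes from giving
  \<open>fresh \<sigma>\<close> exactly \<open>n + 1 + idx \<sigma>\<close> members.\<close>

lemma ex_large_elements:
  fixes R :: "'b set"
  assumes "finite R"
  obtains fresh :: "'b \<Rightarrow> 'v" where "inj_on fresh R"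
    and "\<And>\<sigma>. n < card (elts (fresh \<sigma>))"
proof -
  obtain idx :: "'b \<Rightarrow> nat" where idx: "inj_on idx R"
    using finite_imp_inj_to_nat_seg[OF assms] by blast
  have "\<exists>u. card (elts u) = k" for k
    using infinite_arbitrarily_large[OF infinite_universe, of k] elts_mk_finite by metis
  then obtain g where g: "\<And>k. card (elts (g k)) = k"
    by metis
  show thesis
  proof
    show "inj_on (\<lambda>\<sigma>. g (Suc (n + idx \<sigma>))) R"
      using idx by (auto simp: inj_on_def) (metis g add_left_cancel Suc_inject)
    show "n < card (elts (g (Suc (n + idx \<sigma>))))" for \<sigma>
      by (simp add: g)
  qed
qed

text \<open>
  The Venn diagram of the sets \<open>M v\<close>, \<open>v \<in> V\<close>, is rebuilt with a single element \<open>b \<sigma>\<close> in each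
  nonempty region \<open>\<sigma>\<close>.  The set \<open>M x\<close> with \<open>(x, y) \<in> S\<close> is one region, whose element has to be
  the new value of \<open>y\<close>; the sets \<open>Z y\<close> make the resulting recursion well-founded.  In all other
  regions the element is taken so large that it differs from every new value.
\<close>

lemma ex_singleton_assignment:
  fixes M :: "var \<Rightarrow> 'v" and Z :: "var \<Rightarrow> 'b set"
  assumes V: "finite V" and S: "S \<subseteq> V \<times> V"
    and atom: "\<And>x y v. (x, y) \<in> S \<Longrightarrow> v \<in> V \<Longrightarrow>
        elts (M x) \<subseteq> elts (M v) \<longleftrightarrow> elts (M x) \<inter> elts (M v) \<noteq> {}"
    and eq: "\<And>x y x' y'. (x, y) \<in> S \<Longrightarrow> (x', y') \<in> S \<Longrightarrow>
        elts (M x) = elts (M x') \<longleftrightarrow> elts (M y) = elts (M y')"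
    and rank: "\<And>x y x' y'. (x, y) \<in> S \<Longrightarrow> (x', y') \<in> S \<Longrightarrow>
        elts (M x) \<subseteq> elts (M y') \<Longrightarrow> Z y \<subset> Z y'"
  obtains M' :: "var \<Rightarrow> 'v"
  where "\<And>x y z. x \<in> V \<Longrightarrow> y \<in> V \<Longrightarrow> z \<in> V \<Longrightarrow>
        elts (M' x) = elts (M' y) - elts (M' z) \<longleftrightarrow> elts (M x) = elts (M y) - elts (M z)"
    and "\<And>x y. (x, y) \<in> S \<Longrightarrow> elts (M' x) = {M' y}"
proof -
  \<comment> \<open>A region is named by the set of those variables in \<open>V\<close> whose values
    contain it. \<open>R\<close> collects the inhabited regions, without the outside of all
    sets.\<close>
  define sig where "sig e = {v \<in> V. e \<in> elts (M v)}" for e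
  define R where "R = range sig - {{}}"
  define Sg where "Sg x = {v \<in> V. elts (M x) \<subseteq> elts (M v)}" for x
  define sing where "sing \<sigma> \<longleftrightarrow> (\<exists>(x, y)\<in>S. x \<in> \<sigma>)" for \<sigma>
  \<comment> \<open>Several variables may compete for one region. By \<open>eq\<close> their old
    values agree, so any choice will do.\<close>
  define Y where "Y \<sigma> = (SOME y. \<exists>x. (x, y) \<in> S \<and> x \<in> \<sigma>)" for \<sigma>
  have "R \<subseteq> Pow V"
    by (auto simp: R_def sig_def)
  then have R: "finite R"
    using V by (meson finite_Pow_iff finite_subset)
  have finR: "finite {\<sigma> \<in> R. P \<sigma>}" for P
    using R by simp
  have Y: "\<exists>x. (x, Y \<sigma>) \<in> S \<and> x \<in> \<sigma>" if "sing \<sigma>" for \<sigma>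
    using that unfolding sing_def Y_def by (metis (mono_tags, lifting) case_prodE someI_ex)
  have sigR: "sig e \<in> R" if "e \<in> elts (M v)" "v \<in> V" for e v
    using that by (auto simp: R_def sig_def)
  \<comment> \<open>By \<open>atom\<close>, \<open>M x\<close> is included in every set that it
    meets, so all its elements lie in one region.\<close>
  have sig_eq: "sig e = Sg x" if "(x, y) \<in> S" "e \<in> elts (M x)" for x y e
    using atom[OF that(1)] that(2) by (auto simp: sig_def Sg_def)
  have R_Sg: "\<sigma> = Sg x" if "\<sigma> \<in> R" "(x, y) \<in> S" "x \<in> \<sigma>" for \<sigma> x y
    using that sig_eq[of x y] by (auto simp: R_def sig_def)
  have Sg: "Sg x \<in> R" "x \<in> Sg x" if "(x, y) \<in> S" for x y
  proof -
    have "x \<in> V" using that S by auto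
    \<comment> \<open>For \<open>v = x\<close> the left side of \<open>atom\<close> is trivially
      true, so the right side yields an element.\<close>
    then have "elts (M x) \<noteq> {}"
      using atom[OF that, of x] by auto
    then obtain e where "e \<in> elts (M x)"
      by blast
    then show "Sg x \<in> R"
      using sig_eq[OF that] sigR[OF _ \<open>x \<in> V\<close>] by metis
    show "x \<in> Sg x"
      using \<open>x \<in> V\<close> by (simp add: Sg_def)
  qed
  \<comment> \<open>Counting turns strict inclusion of the possibly infinite sets \<open>Z\<close>
    into a natural number. \<open>Suc\<close> puts the singleton regions above all others.\<close>
  define rk where "rk \<sigma> = (if sing \<sigma> then Suc (card {\<tau> \<in> R. Z (Y \<tau>) \<subset> Z (Y \<sigma>)}) else 0)" for \<sigma>
  have rk: "rk \<tau> < rk \<sigma>" if "\<tau> \<in> R" "sing \<sigma>" "Y \<sigma> \<in> \<tau>" for \<sigma> \<tau>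
  proof (cases "sing \<tau>")
    case True
    obtain x where x: "(x, Y \<tau>) \<in> S" "x \<in> \<tau>"
      using Y[OF True] by blast
    obtain x' where x': "(x', Y \<sigma>) \<in> S"
      using Y[OF \<open>sing \<sigma>\<close>] by blast
    have "\<tau> = Sg x"
      using R_Sg that(1) x by blast
    then have "elts (M x) \<subseteq> elts (M (Y \<sigma>))"
      using that(3) by (simp add: Sg_def)
    then have Z: "Z (Y \<tau>) \<subset> Z (Y \<sigma>)"
      using rank x(1) x' by blast
    \<comment> \<open>The region \<open>\<tau>\<close> itself belongs to the right side
      only.\<close>
    have "{\<upsilon> \<in> R. Z (Y \<upsilon>) \<subset> Z (Y \<tau>)} \<subset> {\<upsilon> \<in> R. Z (Y \<upsilon>) \<subset> Z (Y \<sigma>)}"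
      using Z that(1) by blast
    then show ?thesis
      using psubset_card_mono[OF finR] True that(2) by (simp add: rk_def)
  qed (use that in \<open>simp add: rk_def\<close>)
  obtain fresh :: "var set \<Rightarrow> 'v" where fresh_inj: "inj_on fresh R"
    and fresh_card: "\<And>\<sigma>. card R < card (elts (fresh \<sigma>))"
    using ex_large_elements[OF R] by blast
  \<comment> \<open>The element of a singleton region is the new value of \<open>Y \<sigma>\<close>,
    which consists of elements of regions of smaller rank.\<close>
  define F where
    "F f \<sigma> = (if sing \<sigma> then mk (f ` {\<tau> \<in> R. Y \<sigma> \<in> \<tau>}) else fresh \<sigma>)" for f \<sigma>
  define b where "b = wfrec (measure rk) F"
  define M' where "M' v = mk (b ` {\<sigma> \<in> R. v \<in> \<sigma>})" for v
  have eltsM': "elts (M' v) = b ` {\<sigma> \<in> R. v \<in> \<sigma>}" for v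
    unfolding M'_def by (rule elts_mk_finite) (simp add: finR)
  have b: "b \<sigma> = (if sing \<sigma> then M' (Y \<sigma>) else fresh \<sigma>)" for \<sigma>
  proof -
    have "b \<sigma> = F (cut b (measure rk) \<sigma>) \<sigma>"
      unfolding b_def by (rule wfrec) simp
    also have "\<dots> = (if sing \<sigma> then M' (Y \<sigma>) else fresh \<sigma>)"
    proof (cases "sing \<sigma>")
      case True
      have "cut b (measure rk) \<sigma> ` {\<tau> \<in> R. Y \<sigma> \<in> \<tau>} = b ` {\<tau> \<in> R. Y \<sigma> \<in> \<tau>}"
        using rk True by (intro image_cong) (auto simp: cut_def)
      then show ?thesis
        using True by (simp add: F_def M'_def)
    qed (simp add: F_def)
    finally show ?thesis .
  qed
  have cardM': "card (elts (M' v)) \<le> card R" for v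
  proof -
    have "card (elts (M' v)) \<le> card {\<sigma> \<in> R. v \<in> \<sigma>}"
      unfolding eltsM' by (rule card_image_le[OF finR])
    also have "\<dots> \<le> card R"
      by (rule card_mono) (use R in auto)
    finally show ?thesis .
  qed
  have fresh_new: "fresh \<sigma> \<noteq> M' v" for \<sigma> v
    using fresh_card cardM' by (metis not_le)
  have mem: "e \<in> elts (M v) \<longleftrightarrow> sig e \<in> {\<sigma> \<in> R. v \<in> \<sigma>}" if "v \<in> V" for e v
    using that sigR[of e v] by (auto simp: sig_def)
  have same: "{\<sigma> \<in> R. v \<in> \<sigma>} = {\<sigma> \<in> R. w \<in> \<sigma>} \<longleftrightarrow> elts (M v) = elts (M w)"
    if "v \<in> V" "w \<in> V" for v w
  proof
    assume *: "{\<sigma> \<in> R. v \<in> \<sigma>} = {\<sigma> \<in> R. w \<in> \<sigma>}"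
    have "e \<in> elts (M v) \<longleftrightarrow> e \<in> elts (M w)" for e
      unfolding mem[OF that(1)] mem[OF that(2)] * ..
    then show "elts (M v) = elts (M w)"
      by blast
  qed (use that in \<open>auto simp: R_def sig_def\<close>)
  \<comment> \<open>Equal elements of two singleton regions are equal new values. By induction these
    come from the same regions, so the old values agree and \<open>eq\<close> identifies the two
    regions.\<close>
  have inj: "\<sigma> \<in> R \<Longrightarrow> \<tau> \<in> R \<Longrightarrow> b \<sigma> = b \<tau> \<Longrightarrow> \<sigma> = \<tau>" for \<sigma> \<tau>
  proof (induction "rk \<sigma>" arbitrary: \<sigma> \<tau> rule: less_induct)
    case less
    have sing_eq: "sing \<sigma> \<longleftrightarrow> sing \<tau>"
      using less.prems(3) fresh_new b[of \<sigma>] b[of \<tau>] by metis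
    show ?case
    proof (cases "sing \<sigma>")
      case False
      then show ?thesis
        using less.prems sing_eq fresh_inj b[of \<sigma>] b[of \<tau>] by (simp add: inj_on_def)
    next
      case True
      obtain x where x: "(x, Y \<sigma>) \<in> S" "x \<in> \<sigma>"
        using Y[OF True] by blast
      obtain x' where x': "(x', Y \<tau>) \<in> S" "x' \<in> \<tau>"
        using Y True sing_eq by blast
      have M'eq: "b ` {\<upsilon> \<in> R. Y \<sigma> \<in> \<upsilon>} = b ` {\<upsilon> \<in> R. Y \<tau> \<in> \<upsilon>}"
        using less.prems(3) True sing_eq b[of \<sigma>] b[of \<tau>] by (simp flip: eltsM')
      \<comment> \<open>The induction is on the rank of the first region only, so
        \<open>\<upsilon>'\<close> needs no rank bound.\<close>
      have uniq: "\<upsilon> = \<upsilon>'" if "\<upsilon> \<in> R" "Y \<sigma> \<in> \<upsilon>" "\<upsilon>' \<in> R" "b \<upsilon> = b \<upsilon>'" for \<upsilon> \<upsilon>'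
        using less.hyps[of \<upsilon> \<upsilon>'] rk[of \<upsilon> \<sigma>] True that by blast
      have "{\<upsilon> \<in> R. Y \<sigma> \<in> \<upsilon>} = {\<upsilon> \<in> R. Y \<tau> \<in> \<upsilon>}"
      proof (intro set_eqI iffI; clarsimp)
        fix \<upsilon> assume "\<upsilon> \<in> R" "Y \<sigma> \<in> \<upsilon>"
        moreover from this obtain \<upsilon>' where "\<upsilon>' \<in> R" "Y \<tau> \<in> \<upsilon>'" "b \<upsilon> = b \<upsilon>'"
          using M'eq by blast
        ultimately show "Y \<tau> \<in> \<upsilon>"
          using uniq by blast
      next
        fix \<upsilon>' assume "\<upsilon>' \<in> R" "Y \<tau> \<in> \<upsilon>'"
        moreover from this have "b \<upsilon>' \<in> b ` {\<upsilon> \<in> R. Y \<sigma> \<in> \<upsilon>}"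
          unfolding M'eq by blast
        then obtain \<upsilon> where "\<upsilon> \<in> R" "Y \<sigma> \<in> \<upsilon>" "b \<upsilon> = b \<upsilon>'"
          by auto
        ultimately show "Y \<sigma> \<in> \<upsilon>'"
          using uniq by blast
      qed
      then have "elts (M (Y \<sigma>)) = elts (M (Y \<tau>))"
        using same x(1) x'(1) S by blast
      then have "elts (M x) = elts (M x')"
        using eq x(1) x'(1) by blast
      then show ?thesis
        using R_Sg[OF less.prems(1) x] R_Sg[OF less.prems(2) x'] by (simp add: Sg_def)
    qed
  qed
  show thesis
  proof
    fix x y z assume V: "x \<in> V" "y \<in> V" "z \<in> V"
    have "inj_on b R"
      using inj by (simp add: inj_on_def)
    then have "elts (M' y) - elts (M' z) = b ` ({\<sigma> \<in> R. y \<in> \<sigma>} - {\<sigma> \<in> R. z \<in> \<sigma>})"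
      unfolding eltsM' by (intro inj_on_image_set_diff[symmetric]) auto
    then have "elts (M' x) = elts (M' y) - elts (M' z) \<longleftrightarrow>
        {\<sigma> \<in> R. x \<in> \<sigma>} = {\<sigma> \<in> R. y \<in> \<sigma>} - {\<sigma> \<in> R. z \<in> \<sigma>}"
      using \<open>inj_on b R\<close> by (simp add: eltsM') (rule inj_on_image_eq_iff, auto)
    also have "\<dots> \<longleftrightarrow> elts (M x) = elts (M y) - elts (M z)"
    proof
      assume *: "{\<sigma> \<in> R. x \<in> \<sigma>} = {\<sigma> \<in> R. y \<in> \<sigma>} - {\<sigma> \<in> R. z \<in> \<sigma>}"
      have "e \<in> elts (M x) \<longleftrightarrow> e \<in> elts (M y) - elts (M z)" for e
        unfolding Diff_iff V[THEN mem] * ..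
      then show "elts (M x) = elts (M y) - elts (M z)"
        by blast
    qed (use V in \<open>auto simp: R_def sig_def\<close>)
    finally show "elts (M' x) = elts (M' y) - elts (M' z) \<longleftrightarrow>
        elts (M x) = elts (M y) - elts (M z)" .
  next
    fix x y assume xy: "(x, y) \<in> S"
    have "{\<sigma> \<in> R. x \<in> \<sigma>} = {Sg x}"
      using R_Sg xy Sg by blast
    then have 1: "elts (M' x) = {b (Sg x)}"
      by (simp add: eltsM')
    have "sing (Sg x)"
      using xy Sg(2)[OF xy] unfolding sing_def by blast
    \<comment> \<open>The variable chosen for \<open>Sg x\<close> may stem from another pair. Since
      \<open>x0\<close> and \<open>x\<close> denote the same region, \<open>eq\<close> shows that
      its new value is still that of \<open>y\<close>.\<close>
    then obtain x0 where x0: "(x0, Y (Sg x)) \<in> S" "x0 \<in> Sg x"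
      and bY: "b (Sg x) = M' (Y (Sg x))"
      using Y b by metis
    have "Sg x = Sg x0"
      using R_Sg[OF Sg(1)[OF xy] x0] .
    then have "elts (M x) = elts (M x0)"
      using x0(2) Sg(2)[OF xy] by (auto simp: Sg_def)
    then have "elts (M y) = elts (M (Y (Sg x)))"
      using eq xy x0(1) by blast
    then have "{\<sigma> \<in> R. y \<in> \<sigma>} = {\<sigma> \<in> R. Y (Sg x) \<in> \<sigma>}"
      using same xy x0(1) S by blast
    then have "M' y = M' (Y (Sg x))"
      by (simp add: M'_def)
    then show "elts (M' x) = {M' y}"
      using 1 bY by simp
  qed
qed

end


section \<open>Structured programs for random access machines\<close>

type_synonym code = "nat \<Rightarrow> instr list"

text \<open>
  Jumps are absolute, so a program fragment is a function of the address at which it is placed.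
  \<open>runs c s K s'\<close> bounds the running time of \<open>c\<close> by \<open>K\<close>, uniformly in the surrounding program.
\<close>

definition runs ::
  "code \<Rightarrow> (nat \<Rightarrow> nat) \<times> nat list \<times> nat list \<Rightarrow> nat \<Rightarrow> (nat \<Rightarrow> nat) \<times> nat list \<times> nat list \<Rightarrow> bool"
  where "runs c s K s' \<longleftrightarrow> (\<exists>t\<le>K. \<forall>pre post.
    (step (pre @ c (length pre) @ post) ^^ t) (length pre, s) =
      (length pre + length (c (length pre)), s'))"

definition block :: "instr list \<Rightarrow> code" where
  "block is a = is"

definition seq :: "code \<Rightarrow> code \<Rightarrow> code" (infixr \<open>;;\<close> 60) where
  "(c1 ;; c2) a = c1 a @ c2 (a + length (c1 a))"

definition if_nonzero :: "nat \<Rightarrow> code \<Rightarrow> code" where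
  "if_nonzero r c a = JumpIfZero r (Suc a + length (c (Suc a))) # c (Suc a)"

text \<open>The exit address lies behind the test, the body and the jump back, hence the
  \<open>2\<close>.\<close>

definition while_nonzero :: "nat \<Rightarrow> code \<Rightarrow> code" where
  "while_nonzero r c a = JumpIfZero r (a + length (c (Suc a)) + 2) # c (Suc a) @ [Jump a]"

text \<open>This excludes jumps, so the effect of a list of such instructions does not depend on its
  address and \<open>run\<close> can use a dummy counter.\<close>

definition straight :: "instr \<Rightarrow> bool" where
  "straight i \<longleftrightarrow> (\<forall>pc s. exec i (pc, s) = (Suc pc, snd (exec i (0, s))))"

lemma straight_simps [simp]:
  "straight (Const i n)" "straight (Add i j k)" "straight (Sub i j k)" "straight (Load i j)"
  "straight (Store i j)" "straight (Read i)" "straight (Print i)"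
  by (auto simp: straight_def)

definition run :: "instr list \<Rightarrow> (nat \<Rightarrow> nat) \<times> nat list \<times> nat list \<Rightarrow> (nat \<Rightarrow> nat) \<times> nat list \<times> nat list"
  where "run is = fold (\<lambda>i s. snd (exec i (0, s))) is"

lemma run_simps [simp]:
  "run [] s = s"
  "run (i # is) s = run is (snd (exec i (0, s)))"
  "run (is @ js) s = run js (run is s)"
  by (simp_all add: run_def)

lemma run_print [simp]: "run (map Print rs) (m, inp, out) = (m, inp, out @ map m rs)"
  by (induction rs arbitrary: out) simp_all

lemma runs_mono: "runs c s K s' \<Longrightarrow> K \<le> L \<Longrightarrow> runs c s L s'"
  unfolding runs_def by (meson le_trans)

lemma runs_block:
  assumes "list_all straight is" "run is s = s'" "length is \<le> K"
  shows "runs (block is) s K s'"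
proof -
  have "(step (pre @ is @ post) ^^ length is) (length pre, s) = (length pre + length is, run is s)"
    for pre post
    using assms(1)
  proof (induction "is" arbitrary: pre s)
    case (Cons i "is")
    have "straight i"
      using Cons.prems by simp
    then have "exec i (length pre, s) = (Suc (length pre), snd (exec i (0, s)))"
      unfolding straight_def by blast
    then have "step (pre @ (i # is) @ post) (length pre, s) =
        (Suc (length pre), snd (exec i (0, s)))"
      by (simp add: step_def nth_append)
    then show ?case
      using Cons.IH[of "pre @ [i]" "snd (exec i (0, s))"] Cons.prems
      by (simp add: funpow_swap1)
  qed simp
  then show ?thesis
    using assms unfolding runs_def block_def by blast
qed

lemma runs_seq:
  assumes "runs c1 s K s'" "runs c2 s' L s''"
  shows "runs (c1 ;; c2) s (K + L) s''"
proof -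
  obtain t1 where t1: "t1 \<le> K"
    "\<And>pre post. (step (pre @ c1 (length pre) @ post) ^^ t1) (length pre, s) =
      (length pre + length (c1 (length pre)), s')"
    using assms(1) unfolding runs_def by blast
  obtain t2 where t2: "t2 \<le> L"
    "\<And>pre post. (step (pre @ c2 (length pre) @ post) ^^ t2) (length pre, s') =
      (length pre + length (c2 (length pre)), s'')"
    using assms(2) unfolding runs_def by blast
  have "(step (pre @ (c1 ;; c2) (length pre) @ post) ^^ (t2 + t1)) (length pre, s) =
      (length pre + length ((c1 ;; c2) (length pre)), s'')" for pre post
    using t1(2)[of pre "c2 (length pre + length (c1 (length pre))) @ post"]
      t2(2)[of "pre @ c1 (length pre)" post]
    by (simp add: seq_def funpow_add add.assoc)
  moreover have "t2 + t1 \<le> K + L"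
    using t1(1) t2(1) by simp
  ultimately show ?thesis
    unfolding runs_def by blast
qed

lemma runs_if_zero:
  assumes "m r = 0"
  shows "runs (if_nonzero r c) (m, inp, out) 1 (m, inp, out)"
  unfolding runs_def
  by (rule exI[of _ 1]) (simp add: assms if_nonzero_def step_def nth_append)

lemma runs_if_nonzero:
  assumes "m r \<noteq> 0" "runs c (m, inp, out) K s'"
  shows "runs (if_nonzero r c) (m, inp, out) (Suc K) s'"
proof -
  obtain t where t: "t \<le> K"
    "\<And>pre post. (step (pre @ c (length pre) @ post) ^^ t) (length pre, m, inp, out) =
      (length pre + length (c (length pre)), s')"
    using assms(2) unfolding runs_def by blast
  have "(step (pre @ if_nonzero r c (length pre) @ post) ^^ Suc t) (length pre, m, inp, out) =
      (length pre + length (if_nonzero r c (length pre)), s')" for pre post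
    using t(2)[of "pre @ [JumpIfZero r (Suc (length pre) + length (c (Suc (length pre))))]" post]
      assms(1)
    by (simp add: if_nonzero_def step_def nth_append funpow_swap1)
  then show ?thesis
    using t(1) unfolding runs_def by (meson Suc_le_mono)
qed

lemma runs_while_zero:
  assumes "m r = 0"
  shows "runs (while_nonzero r c) (m, inp, out) 1 (m, inp, out)"
  unfolding runs_def
  by (rule exI[of _ 1]) (simp add: assms while_nonzero_def step_def nth_append)

lemma runs_while_nonzero:
  assumes "m r \<noteq> 0" "runs c (m, inp, out) K s'" "runs (while_nonzero r c) s' L s''"
  shows "runs (while_nonzero r c) (m, inp, out) (K + L + 2) s''"
proof -
  obtain t1 where t1: "t1 \<le> K"
    "\<And>pre post. (step (pre @ c (length pre) @ post) ^^ t1) (length pre, m, inp, out) =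
      (length pre + length (c (length pre)), s')"
    using assms(2) unfolding runs_def by blast
  obtain t2 where t2: "t2 \<le> L"
    "\<And>pre post. (step (pre @ while_nonzero r c (length pre) @ post) ^^ t2) (length pre, s') =
      (length pre + length (while_nonzero r c (length pre)), s'')"
    using assms(3) unfolding runs_def by blast
  have "(step (pre @ while_nonzero r c (length pre) @ post) ^^ (t2 + Suc (t1 + 1)))
      (length pre, m, inp, out) = (length pre + length (while_nonzero r c (length pre)), s'')"
    for pre post
  proof -
    let ?a = "length pre"
    let ?c = "c (Suc ?a)"
    let ?P = "pre @ while_nonzero r c ?a @ post"
    have P: "?P = (pre @ [JumpIfZero r (?a + length ?c + 2)]) @ ?c @ Jump ?a # post"
      by (simp add: while_nonzero_def)
    have 1: "(step ?P ^^ 1) (?a, m, inp, out) = (Suc ?a, m, inp, out)"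
      using assms(1) by (simp add: while_nonzero_def step_def nth_append)
    have 2: "(step ?P ^^ t1) (Suc ?a, m, inp, out) = (Suc ?a + length ?c, s')"
      using t1(2)[of "pre @ [JumpIfZero r (?a + length ?c + 2)]" "Jump ?a # post"]
      unfolding P by simp
    have 3: "(step ?P ^^ 1) (Suc ?a + length ?c, s') = (?a, s')"
      by (cases s') (simp add: while_nonzero_def step_def nth_append)
    have "(step ?P ^^ (t2 + (1 + (t1 + 1)))) (?a, m, inp, out) = (step ?P ^^ t2) (?a, s')"
      unfolding funpow_add comp_apply 1 2 3 ..
    then show ?thesis
      using t2(2) by simp
  qed
  moreover have "t2 + Suc (t1 + 1) \<le> K + L + 2"
    using t1(1) t2(1) by simp
  ultimately show ?thesis
    unfolding runs_def by blast
qed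

text \<open>A halted configuration is a fixed point of \<open>step\<close>, so a shorter run can be
  padded to exactly \<open>K\<close> steps.\<close>

lemma ram_computes_within_if_runs:
  assumes "runs c (\<lambda>_. 0, inp, []) K (m, inp', out)"
  shows "ram_computes_within (c 0) inp out K"
proof -
  obtain t where t: "t \<le> K"
    and eq: "(step (c 0) ^^ t) (0, \<lambda>_. 0, inp, []) = (length (c 0), m, inp', out)"
    using assms unfolding runs_def by (metis append_Nil append_Nil2 add_0 list.size(3))
  have "(step (c 0) ^^ k) (length (c 0), m, inp', out) = (length (c 0), m, inp', out)" for k
    by (induction k) (simp_all add: step_def)
  then have "(step (c 0) ^^ (K - t + t)) (0, \<lambda>_. 0, inp, []) = (length (c 0), m, inp', out)"
    using eq unfolding funpow_add by simp
  then show ?thesis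
    using t unfolding ram_computes_within_def by auto
qed

section \<open>Scanning a word stored in memory\<close>

primrec stored :: "(nat \<Rightarrow> nat) \<Rightarrow> nat \<Rightarrow> nat list \<Rightarrow> bool" where
  "stored m a [] \<longleftrightarrow> True"
| "stored m a (t # ts) \<longleftrightarrow> m a = t \<and> stored m (Suc a) ts"

lemma stored_append: "stored m a (ts @ us) \<longleftrightarrow> stored m a ts \<and> stored m (a + length ts) us"
  by (induction ts arbitrary: a) simp_all

lemma stored_nth: "stored m a ts \<Longrightarrow> i < length ts \<Longrightarrow> m (a + i) = ts ! i"
proof (induction ts arbitrary: a i)
  case (Cons t ts)
  then show ?case by (cases i) fastforce+
qed simp

text \<open>
  In the code of a formula the symbol \<open>2\<close> is followed by the two variables of an atom \<open>SingEq\<close>,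
  and the symbols greater than \<open>7\<close> are the variables; no further parsing is needed.
\<close>

primrec scan :: "(nat \<Rightarrow> nat \<Rightarrow> 'a list) \<Rightarrow> (nat \<Rightarrow> 'a list) \<Rightarrow> (nat \<Rightarrow> nat) \<Rightarrow> nat \<Rightarrow> nat \<Rightarrow> 'a list" where
  "scan F G m a 0 = []"
| "scan F G m a (Suc n) = (if m a = 2 then F (m (a + 1)) (m (a + 2)) else []) @
     (if 7 < m a then G (m a) else []) @ scan F G m (Suc a) n"

lemma scan_add: "scan F G m a (k + n) = scan F G m a k @ scan F G m (a + k) n"
  by (induction k arbitrary: a) simp_all

primrec collect :: "(var \<Rightarrow> var \<Rightarrow> 'a list) \<Rightarrow> (var \<Rightarrow> 'a list) \<Rightarrow> fm \<Rightarrow> 'a list" where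
  "collect f g (DiffEq x y z) = g x @ g y @ g z"
| "collect f g (SingEq x y) = f x y @ g x @ g y"
| "collect f g (Neg p) = collect f g p"
| "collect f g (Conj p q) = collect f g p @ collect f g q"
| "collect f g (Disj p q) = collect f g p @ collect f g q"
| "collect f g (Imp p q) = collect f g p @ collect f g q"
| "collect f g (Iff p q) = collect f g p @ collect f g q"

text \<open>Only \<open>SingEq\<close> has symbol \<open>2\<close> and only variables exceed
  \<open>7\<close>, so each symbol alone decides what is emitted. The look-ahead after a
  \<open>2\<close> stays inside the atom.\<close>

lemma scan_encode:
  "stored m a (encode p) \<Longrightarrow>
    scan F G m a (length (encode p)) = collect (\<lambda>x y. F (x + 8) (y + 8)) (\<lambda>v. G (v + 8)) p"
proof (induction p arbitrary: a)
  case (DiffEq x y z)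
  then show ?case by (auto simp: numeral_eq_Suc)
next
  case (SingEq x y)
  then show ?case by (auto simp: numeral_eq_Suc)
qed (auto simp: stored_append scan_add)

lemma concat_map_collect:
  "concat (map h (collect f g p)) =
    collect (\<lambda>x y. concat (map h (f x y))) (\<lambda>v. concat (map h (g v))) p"
  by (induction p) simp_all

definition read_loop :: code where
  "read_loop = while_nonzero 9 (block [Add 0 0 9, Store 8 9, Add 8 8 1, Read 9])"

text \<open>Register \<open>9\<close> is one symbol ahead of the tape. No symbol is
  \<open>0\<close>, so the \<open>0\<close> read past the end stops the loop. Each symbol costs four
  instructions, a test and a jump.\<close>

lemma runs_read_loop:
  assumes "0 \<notin> set ts" "20 \<le> m 8" "m 1 = 1" "m 9 = hd (ts @ [0])"
  shows "\<exists>m'. runs read_loop (m, tl ts, out) (6 * length ts + 1) (m', [], out) \<and>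
    m' 0 = m 0 + sum_list ts \<and> stored m' (m 8) ts \<and>
    (\<forall>r. r \<notin> {0, 8, 9} \<and> (r < m 8 \<or> m 8 + length ts \<le> r) \<longrightarrow> m' r = m r)"
  using assms
proof (induction ts arbitrary: m)
  case Nil
  then have "runs read_loop (m, [], out) 1 (m, [], out)"
    unfolding read_loop_def by (intro runs_while_zero) simp
  then show ?case by auto
next
  case (Cons t ts)
  define m1 where "m1 = m(0 := m 0 + t, m 8 := t, 8 := Suc (m 8), 9 := hd (ts @ [0]))"
  have m1: "m1 0 = m 0 + t" "m1 (m 8) = t" "m1 8 = Suc (m 8)" "m1 9 = hd (ts @ [0])"
    "m1 1 = 1" "\<And>r. r \<notin> {0, 8, 9, m 8} \<Longrightarrow> m1 r = m r"
    using Cons.prems by (auto simp: m1_def)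
  have body: "runs (block [Add 0 0 9, Store 8 9, Add 8 8 1, Read 9]) (m, ts, out) 4 (m1, tl ts, out)"
    using Cons.prems by (intro runs_block) (auto simp: m1_def fun_eq_iff split: list.split)
  obtain m' where m': "runs read_loop (m1, tl ts, out) (6 * length ts + 1) (m', [], out)"
    "m' 0 = m1 0 + sum_list ts" "stored m' (m1 8) ts"
    "\<And>r. r \<notin> {0, 8, 9} \<and> (r < m1 8 \<or> m1 8 + length ts \<le> r) \<Longrightarrow> m' r = m1 r"
    using Cons.IH[of m1] Cons.prems m1 by auto
  have "runs read_loop (m, ts, out) (6 * length (t # ts) + 1) (m', [], out)"
  proof -
    have "runs read_loop (m, ts, out) (4 + (6 * length ts + 1) + 2) (m', [], out)"
      using body m'(1) Cons.prems unfolding read_loop_def by (intro runs_while_nonzero) auto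
    then show ?thesis by (rule runs_mono) simp
  qed
  moreover have "m' (m 8) = t"
    using m'(4)[of "m 8"] m1 Cons.prems by auto
  moreover have "m' r = m r"
    if "r \<notin> {0, 8, 9} \<and> (r < m 8 \<or> m 8 + length (t # ts) \<le> r)" for r
    using that m'(4)[of r] m1 by auto
  ultimately show ?case
    using m'(2,3) m1 by (intro exI[of _ m']) auto
qed

text \<open>With truncated subtraction, \<open>1 - ((t - 2) + (2 - t))\<close> is nonzero iff the
  symbol is \<open>2\<close>, and \<open>t - 7\<close> is nonzero iff it is a variable.\<close>

definition scan_step :: "nat \<Rightarrow> nat \<Rightarrow> nat \<Rightarrow> code \<Rightarrow> code \<Rightarrow> code" where
  "scan_step p t d cf cg =
     block [Sub d t 2, Sub 5 2 t, Add d d 5, Sub d 1 d] ;; if_nonzero d cf ;;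
     block [Sub d t 7] ;; if_nonzero d cg ;; block [Add p p 1, Load t p]"

definition scan_loop :: "nat \<Rightarrow> nat \<Rightarrow> nat \<Rightarrow> code \<Rightarrow> code \<Rightarrow> code" where
  "scan_loop p t d cf cg = block [Load t p] ;; while_nonzero t (scan_step p t d cf cg)"

text \<open>\<open>R\<close> holds the registers that the bodies may change, \<open>W\<close> also
  those of the loop. Outputs are expressed through the reference memory \<open>m0\<close>, which
  agrees with the current one outside \<open>W\<close>; this allows nesting. A round costs at most
  \<open>2 * K + 9\<close> steps plus test and jump.\<close>

lemma runs_scan_loop:
  fixes m0 :: "nat \<Rightarrow> nat"
  assumes W: "W = {p, t, d} \<union> R" "W \<subseteq> {..<20}" "5 \<in> R" "{1, 2, 7} \<inter> W = {}"
    "distinct [p, t, d]" "{p, t, d} \<inter> R = {}"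
    and cst: "m0 1 = 1" "m0 2 = 2" "m0 7 = 7"
    and cf: "\<And>m out. \<forall>r. r \<notin> W \<longrightarrow> m r = m0 r \<Longrightarrow> 20 \<le> m p \<Longrightarrow>
      \<exists>m'. runs cf (m, inp, out) K (m', inp, out @ F (m0 (m p + 1)) (m0 (m p + 2))) \<and>
        (\<forall>r. r \<notin> R \<longrightarrow> m' r = m r)"
    and cg: "\<And>m out. \<forall>r. r \<notin> W \<longrightarrow> m r = m0 r \<Longrightarrow> 20 \<le> m p \<Longrightarrow>
      \<exists>m'. runs cg (m, inp, out) K (m', inp, out @ G (m t)) \<and> (\<forall>r. r \<notin> R \<longrightarrow> m' r = m r)"
    and m: "\<forall>r. r \<notin> W \<longrightarrow> m r = m0 r" "20 \<le> m p"
    and n: "\<And>i. i < n \<Longrightarrow> m0 (m p + i) \<noteq> 0" "m0 (m p + n) = 0"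
  shows "\<exists>m'. runs (scan_loop p t d cf cg) (m, inp, out) ((2 * K + 11) * n + 2)
      (m', inp, out @ scan F G m0 (m p) n) \<and> (\<forall>r. r \<notin> W \<longrightarrow> m' r = m0 r)"
proof -
  have outside: "r \<notin> W" if "20 \<le> r" for r
    using W(2) that by (meson lessThan_iff not_le subsetD)
  have ne: "p \<noteq> t" "p \<noteq> d" "t \<noteq> d" "p \<noteq> 5" "t \<noteq> 5" "d \<noteq> 5"
    using W(3,5,6) by auto
  have const_ne: "p \<noteq> 1" "t \<noteq> 1" "d \<noteq> 1" "p \<noteq> 2" "t \<noteq> 2" "d \<noteq> 2" "p \<noteq> 7" "t \<noteq> 7" "d \<noteq> 7"
    using W(1,4) by auto
  have dist_two: "Suc 0 \<le> a - 2 + (2 - a)" if "a \<noteq> 2" for a :: nat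
    using that by (cases "a < 2") auto
  have loop: "\<exists>m'. runs (while_nonzero t (scan_step p t d cf cg)) (m, inp, out)
      ((2 * K + 11) * n + 1) (m', inp, out @ scan F G m0 (m p) n) \<and> (\<forall>r. r \<notin> W \<longrightarrow> m' r = m0 r)"
    if "\<forall>r. r \<notin> W \<longrightarrow> m r = m0 r" "20 \<le> m p" "m t = m0 (m p)"
      "\<And>i. i < n \<Longrightarrow> m0 (m p + i) \<noteq> 0" "m0 (m p + n) = 0" for m n out
    using that
  proof (induction n arbitrary: m out)
    case 0
    then have "runs (while_nonzero t (scan_step p t d cf cg)) (m, inp, out) 1 (m, inp, out)"
      by (intro runs_while_zero) simp
    then show ?case
      using 0 by auto
  next
    case (Suc n)
    let ?a = "m p"
    have c: "m 1 = 1" "m 2 = 2" "m 7 = 7"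
      using Suc.prems(1) W(4) cst by auto
    define m1 where
      "m1 = m(5 := 2 - m t, d := (if m t = 2 then 1 else 0))"
    have "runs (block [Sub d t 2, Sub 5 2 t, Add d d 5, Sub d 1 d]) (m, inp, out) 4 (m1, inp, out)"
      using ne const_ne c by (intro runs_block) (auto simp: m1_def fun_eq_iff dist_two)
    moreover
    have m1: "\<forall>r. r \<notin> W \<longrightarrow> m1 r = m0 r" "m1 p = ?a" "m1 t = m t"
      using Suc.prems(1) ne W(1,3) by (auto simp: m1_def)
    define out2 where "out2 = out @ (if m0 ?a = 2 then F (m0 (?a + 1)) (m0 (?a + 2)) else [])"
    obtain m2 where "runs (if_nonzero d cf) (m1, inp, out) (Suc K) (m2, inp, out2)"
      and m2_R: "\<forall>r. r \<notin> R \<longrightarrow> m2 r = m1 r"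
    proof (cases "m t = 2")
      case True
      obtain m2 where "runs cf (m1, inp, out) K (m2, inp, out @ F (m0 (m1 p + 1)) (m0 (m1 p + 2)))"
        and m2: "\<forall>r. r \<notin> R \<longrightarrow> m2 r = m1 r"
        using cf[of m1 out] m1 Suc.prems(2) by auto
      then have "runs (if_nonzero d cf) (m1, inp, out) (Suc K) (m2, inp, out2)"
        using True m1(2) Suc.prems(3) by (intro runs_if_nonzero) (simp_all add: m1_def out2_def)
      then show ?thesis using m2 that by blast
    next
      case False
      then have "runs (if_nonzero d cf) (m1, inp, out) 1 (m1, inp, out)"
        by (intro runs_if_zero) (simp add: m1_def)
      then have "runs (if_nonzero d cf) (m1, inp, out) (Suc K) (m1, inp, out2)"
        using False Suc.prems(3) by (auto simp: out2_def elim: runs_mono)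
      then show ?thesis using that by blast
    qed
    moreover
    have m2: "\<forall>r. r \<notin> W \<longrightarrow> m2 r = m0 r" "m2 p = ?a" "m2 t = m t" "m2 7 = 7"
      using m2_R m1 W(1,4,6) cst by auto
    define m3 where "m3 = m2(d := m t - 7)"
    have "runs (block [Sub d t 7]) (m2, inp, out2) 1 (m3, inp, out2)"
      using m2 by (intro runs_block) (auto simp: m3_def)
    moreover
    have m3: "\<forall>r. r \<notin> W \<longrightarrow> m3 r = m0 r" "m3 p = ?a" "m3 t = m t"
      using m2 ne W(1) by (auto simp: m3_def)
    define out4 where "out4 = out2 @ (if 7 < m0 ?a then G (m0 ?a) else [])"
    obtain m4 where "runs (if_nonzero d cg) (m3, inp, out2) (Suc K) (m4, inp, out4)"
      and m4_R: "\<forall>r. r \<notin> R \<longrightarrow> m4 r = m3 r"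
    proof (cases "7 < m t")
      case True
      obtain m4 where "runs cg (m3, inp, out2) K (m4, inp, out2 @ G (m3 t))"
        and m4: "\<forall>r. r \<notin> R \<longrightarrow> m4 r = m3 r"
        using cg[of m3 out2] m3 Suc.prems(2) by auto
      then have "runs (if_nonzero d cg) (m3, inp, out2) (Suc K) (m4, inp, out4)"
        using True m3(3) Suc.prems(3) by (intro runs_if_nonzero) (simp_all add: m3_def out4_def)
      then show ?thesis using m4 that by blast
    next
      case False
      then have "runs (if_nonzero d cg) (m3, inp, out2) 1 (m3, inp, out2)"
        by (intro runs_if_zero) (simp add: m3_def)
      then have "runs (if_nonzero d cg) (m3, inp, out2) (Suc K) (m3, inp, out4)"
        using False Suc.prems(3) by (auto simp: out4_def elim: runs_mono)
      then show ?thesis using that by blast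
    qed
    moreover
    have m4: "\<forall>r. r \<notin> W \<longrightarrow> m4 r = m0 r" "m4 p = ?a" "m4 1 = 1"
      using m4_R m3 W(1,4,6) cst by auto
    define m5 where "m5 = m4(p := Suc ?a, t := m0 (Suc ?a))"
    \<comment> \<open>Addresses from \<open>20\<close> on lie outside \<open>W\<close>, so the
      stored input is intact.\<close>
    have "m4 (Suc ?a) = m0 (Suc ?a)" "Suc ?a \<noteq> p"
      using m4(1) outside[of "Suc ?a"] Suc.prems(2) W(1) by auto
    then have "runs (block [Add p p 1, Load t p]) (m4, inp, out4) 2 (m5, inp, out4)"
      using m4 by (intro runs_block) (auto simp: m5_def)
    ultimately have
      "runs (scan_step p t d cf cg) (m, inp, out) (4 + (Suc K + (1 + (Suc K + 2)))) (m5, inp, out4)"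
      unfolding scan_step_def by (intro runs_seq)
    moreover
    have m5: "\<forall>r. r \<notin> W \<longrightarrow> m5 r = m0 r" "m5 p = Suc ?a" "m5 t = m0 (m5 p)"
      using m4 W(1) ne by (auto simp: m5_def)
    have "m0 (m5 p + i) \<noteq> 0" if "i < n" for i
      using Suc.prems(4)[of "Suc i"] m5(2) that by simp
    then obtain m' where "runs (while_nonzero t (scan_step p t d cf cg)) (m5, inp, out4)
        ((2 * K + 11) * n + 1) (m', inp, out4 @ scan F G m0 (m5 p) n)"
      and m': "\<forall>r. r \<notin> W \<longrightarrow> m' r = m0 r"
      using Suc.IH[of m5 out4] m5 Suc.prems(2,5) by auto
    moreover have "m t \<noteq> 0"
      using Suc.prems(3) Suc.prems(4)[of 0] by simp
    ultimately have "runs (while_nonzero t (scan_step p t d cf cg)) (m, inp, out)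
        (4 + (Suc K + (1 + (Suc K + 2))) + ((2 * K + 11) * n + 1) + 2)
        (m', inp, out4 @ scan F G m0 (m5 p) n)"
      by (intro runs_while_nonzero)
    then have "runs (while_nonzero t (scan_step p t d cf cg)) (m, inp, out)
        ((2 * K + 11) * Suc n + 1) (m', inp, out4 @ scan F G m0 (m5 p) n)"
      by (rule runs_mono) simp
    moreover have "out4 @ scan F G m0 (m5 p) n = out @ scan F G m0 ?a (Suc n)"
      by (simp add: out4_def out2_def m5(2))
    ultimately show ?case
      using m' by auto
  qed
  define m1 where "m1 = m(t := m0 (m p))"
  have m1: "\<forall>r. r \<notin> W \<longrightarrow> m1 r = m0 r" "m1 p = m p" "m1 t = m0 (m1 p)"
    using m W(1) ne by (auto simp: m1_def)
  have start: "runs (block [Load t p]) (m, inp, out) 1 (m1, inp, out)"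
    using m outside[of "m p"] by (intro runs_block) (auto simp: m1_def)
  obtain m' where "runs (while_nonzero t (scan_step p t d cf cg)) (m1, inp, out)
      ((2 * K + 11) * n + 1) (m', inp, out @ scan F G m0 (m1 p) n)"
    and m': "\<forall>r. r \<notin> W \<longrightarrow> m' r = m0 r"
    using loop[of m1 n out] m1 m(2) n by auto
  from runs_seq[OF start this(1)] have
    "runs (scan_loop p t d cf cg) (m, inp, out) ((2 * K + 11) * n + 2)
      (m', inp, out @ scan F G m0 (m p) n)"
    unfolding scan_loop_def m1(2) by (rule runs_mono) simp
  then show ?thesis
    using m' by blast
qed


section \<open>The formula and its computation\<close>

text \<open>
  The number \<open>s\<close> is the sum of all symbols of the input; it exceeds the code of each variable.  So
  \<open>s - 8\<close>, whose code is \<open>s\<close>, is a new variable, used for the empty set, and \<open>y + s\<close> is the new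
  variable attached to \<open>y\<close>.  The equivalence in \<open>atom_fm\<close> fails if \<open>x\<close> is empty.
\<close>

definition atom_fm :: "nat \<Rightarrow> var \<Rightarrow> var \<Rightarrow> fm" where
  "atom_fm s x v = Iff (DiffEq (s - 8) x v) (Neg (DiffEq x x v))"

text \<open>While \<open>s - 8\<close> is empty, \<open>DiffEq x x' (s - 8)\<close> expresses
  equality and \<open>DiffEq (s - 8) x y'\<close> inclusion of \<open>x\<close> in
  \<open>y'\<close>.\<close>

definition link_fm :: "nat \<Rightarrow> var \<Rightarrow> var \<Rightarrow> var \<Rightarrow> var \<Rightarrow> fm" where
  "link_fm s x y x' y' =
     Conj (Iff (DiffEq x x' (s - 8)) (DiffEq y y' (s - 8)))
       (Imp (DiffEq (s - 8) x y')
         (Conj (DiffEq (s - 8) (y + s) (y' + s)) (Neg (DiffEq (s - 8) (y' + s) (y + s)))))"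

text \<open>The nested traversal has the shape of the nested scans. Conjuncts are repeated for
  repeated occurrences, so the machine keeps no table of variables.\<close>

definition conjuncts :: "nat \<Rightarrow> fm \<Rightarrow> fm list" where
  "conjuncts s p =
     collect (\<lambda>x y. collect (\<lambda>x' y'. [link_fm s x y x' y']) (\<lambda>v. [atom_fm s x v]) p) (\<lambda>_. []) p"

text \<open>The innermost conjunct forces \<open>s - 8\<close> to be empty. Nesting to the right
  makes the word a plain concatenation, each conjunct preceded by \<open>4\<close>.\<close>

definition Xi :: "fm \<Rightarrow> fm \<Rightarrow> fm" where
  "Xi \<phi> \<psi> = (let p = Conj \<phi> \<psi>; s = sum_list (encode p)
     in foldr Conj (conjuncts s p) (DiffEq (s - 8) (s - 8) (s - 8)))"

section \<open>Words of the formula and the machine printing them\<close>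

lemma encode_foldr_Conj:
  "encode (foldr Conj ps q) = concat (map (\<lambda>p. 4 # encode p) ps) @ encode q"
  by (induction ps) simp_all

lemma var_less_sum_list_encode: "v \<in> vars p \<Longrightarrow> v + 8 \<le> sum_list (encode p)"
  by (induction p) auto

lemma vars_nonempty: "vars p \<noteq> {}"
  by (induction p) auto

text \<open>This makes the truncated subtraction in \<open>s - 8\<close> exact, so the symbol of
  that variable is \<open>s\<close>, the content of register \<open>0\<close>.\<close>

lemma eight_le_sum_list_encode: "8 \<le> sum_list (encode p)"
  using vars_nonempty[of p] var_less_sum_list_encode[of _ p] by fastforce

lemma zero_notin_encode: "0 \<notin> set (encode p)"
  by (induction p) auto

text \<open>
  Register \<open>i \<in> {1, 2, 3, 4, 6, 7}\<close> holds the constant \<open>i\<close>, register \<open>0\<close> the sum \<open>s\<close>, and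
  register \<open>5\<close> is scratch.  The outer scan has pointer, symbol and flag in \<open>8, 9, 10\<close> and
  \<open>x, y, y + s\<close> in \<open>11, 12, 13\<close>; the inner one has them in \<open>14, 15, 16\<close> and \<open>17, 18, 19\<close>.  The
  input is stored from address \<open>20\<close> on and is terminated by \<open>0\<close>.
\<close>

definition print_atom :: code where
  "print_atom = block (map Print [4, 7, 1, 0, 11, 15, 3, 1, 11, 11, 15])"

definition print_link :: code where
  "print_link = block ([Add 5 14 1, Load 17 5, Add 5 5 1, Load 18 5, Add 19 18 0] @
     map Print [4, 4, 7, 1, 11, 17, 0, 1, 12, 18, 0, 6, 1, 0, 11, 18,
       4, 1, 0, 13, 19, 3, 1, 0, 19, 13])"

definition print_row :: code where
  "print_row =
     block [Add 5 8 1, Load 11 5, Add 5 5 1, Load 12 5, Add 13 12 0, Const 14 20] ;;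
     scan_loop 14 15 16 print_link print_atom"

definition Xi_code :: code where
  "Xi_code =
     block [Const 1 1, Const 2 2, Const 3 3, Const 4 4, Const 6 6, Const 7 7, Const 8 20, Read 9] ;;
     read_loop ;;
     block [Const 8 20] ;; scan_loop 8 9 10 print_row (block []) ;;
     block (map Print [1, 0, 0, 0])"

text \<open>The arguments are symbols, already shifted by \<open>8\<close>; adding \<open>s\<close>
  to the symbol of \<open>y\<close> gives the symbol of \<open>y + s\<close>. The first
  \<open>4\<close> is the enclosing conjunction.\<close>

definition link_code :: "nat \<Rightarrow> nat \<Rightarrow> nat \<Rightarrow> nat \<Rightarrow> nat \<Rightarrow> nat list" where
  "link_code s x y x' y' = [4, 4, 7, 1, x, x', s, 1, y, y', s, 6, 1, s, x, y',
     4, 1, s, y + s, y' + s, 3, 1, s, y' + s, y + s]"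

definition atom_code :: "nat \<Rightarrow> nat \<Rightarrow> nat \<Rightarrow> nat list" where
  "atom_code s x v = [4, 7, 1, s, x, v, 3, 1, x, x, v]"

text \<open>Both inner bodies take at most \<open>31\<close> steps, and
  \<open>73 = 2 * 31 + 11\<close>.\<close>

lemma runs_print_row:
  fixes m0 :: "nat \<Rightarrow> nat"
  assumes cst: "m0 1 = 1" "m0 2 = 2" "m0 3 = 3" "m0 4 = 4" "m0 6 = 6" "m0 7 = 7"
    and n: "\<And>i. i < n \<Longrightarrow> m0 (20 + i) \<noteq> 0" "m0 (20 + n) = 0"
    and m: "\<forall>r. r \<notin> {8, 9, 10} \<union> {5, 11, 12, 13, 14, 15, 16, 17, 18, 19} \<longrightarrow> m r = m0 r"
      "20 \<le> m 8"
  shows "\<exists>m'. runs print_row (m, inp, out) (73 * n + 8)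
      (m', inp, out @ scan (link_code (m0 0) (m0 (m 8 + 1)) (m0 (m 8 + 2)))
        (atom_code (m0 0) (m0 (m 8 + 1))) m0 20 n) \<and>
    (\<forall>r. r \<notin> {5, 11, 12, 13, 14, 15, 16, 17, 18, 19} \<longrightarrow> m' r = m r)"
proof -
  let ?x = "m0 (m 8 + 1)" and ?y = "m0 (m 8 + 2)"
  define m1 where "m1 = m(5 := m 8 + 2, 11 := ?x, 12 := ?y, 13 := ?y + m0 0, 14 := 20)"
  have hi: "m (Suc (m 8)) = m0 (Suc (m 8))" "m (Suc (Suc (m 8))) = m0 (Suc (Suc (m 8)))"
    using m by auto
  have 1: "runs (block [Add 5 8 1, Load 11 5, Add 5 5 1, Load 12 5, Add 13 12 0, Const 14 20])
      (m, inp, out) 6 (m1, inp, out)"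
    using m cst hi by (intro runs_block) (auto simp: m1_def fun_eq_iff)
  have eq: "\<And>i. 20 \<le> i \<Longrightarrow> m1 i = m0 i"
    using m by (auto simp: m1_def)
  \<comment> \<open>A scan from \<open>20\<close> on never looks at the registers, the only places
    where \<open>m1\<close> and \<open>m0\<close> may differ.\<close>
  have scan_cong: "(\<And>i. 20 \<le> i \<Longrightarrow> m1 i = m0 i) \<Longrightarrow> 20 \<le> a \<Longrightarrow>
      scan F G m1 a n = scan F G m0 a n" for F G a n and m1 :: "nat \<Rightarrow> nat"
    by (induction n arbitrary: a) auto
  have "\<exists>m'. runs (scan_loop 14 15 16 print_link print_atom) (m1, inp, out) ((2 * 31 + 11) * n + 2)
      (m', inp, out @ scan (link_code (m0 0) ?x ?y) (atom_code (m0 0) ?x) m1 (m1 14) n) \<and>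
    (\<forall>r. r \<notin> {14, 15, 16, 5, 17, 18, 19} \<longrightarrow> m' r = m1 r)"
  proof (rule runs_scan_loop[where R = "{5, 17, 18, 19}"])
    fix m' :: "nat \<Rightarrow> nat" and out
    assume m': "\<forall>r. r \<notin> {14, 15, 16, 5, 17, 18, 19} \<longrightarrow> m' r = m1 r" "20 \<le> m' 14"
    have regs: "m' 0 = m0 0" "m' (Suc 0) = 1" "m' 3 = 3" "m' 4 = 4" "m' 6 = 6" "m' 7 = 7" "m' 11 = ?x"
      "m' 12 = ?y" "m' 13 = ?y + m0 0"
      using m'(1) m cst by (auto simp: m1_def)
    have hi': "m' (Suc (m' 14)) = m1 (Suc (m' 14))" "m' (Suc (Suc (m' 14))) = m1 (Suc (Suc (m' 14)))"
      using m' by auto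
    let ?u = "m1 (m' 14 + 1)" and ?v = "m1 (m' 14 + 2)"
    let ?m = "m'(5 := m' 14 + 2, 17 := ?u, 18 := ?v, 19 := ?v + m0 0)"
    have "runs print_link (m', inp, out) 31 (?m, inp, out @ link_code (m0 0) ?x ?y ?u ?v)"
      unfolding print_link_def
      using m' regs hi' by (intro runs_block) (auto simp: link_code_def fun_eq_iff)
    then show "\<exists>m''. runs print_link (m', inp, out) 31 (m'', inp, out @ link_code (m0 0) ?x ?y ?u ?v) \<and>
        (\<forall>r. r \<notin> {5, 17, 18, 19} \<longrightarrow> m'' r = m' r)"
      by (intro exI[of _ ?m]) auto
    have "runs print_atom (m', inp, out) 31 (m', inp, out @ atom_code (m0 0) ?x (m' 15))"
      unfolding print_atom_def
      using regs by (intro runs_block) (auto simp: atom_code_def)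
    then show "\<exists>m''. runs print_atom (m', inp, out) 31 (m'', inp, out @ atom_code (m0 0) ?x (m' 15)) \<and>
        (\<forall>r. r \<notin> {5, 17, 18, 19} \<longrightarrow> m'' r = m' r)"
      by blast
  next
    show "m1 (m1 14 + i) \<noteq> 0" if "i < n" for i
      using n(1)[OF that] eq[of "20 + i"] by (simp add: m1_def)
    show "m1 (m1 14 + n) = 0"
      using n(2) eq[of "20 + n"] by (simp add: m1_def)
  qed (use m cst in \<open>auto simp: m1_def\<close>)
  then obtain m' where 2: "runs (scan_loop 14 15 16 print_link print_atom) (m1, inp, out)
      ((2 * 31 + 11) * n + 2)
      (m', inp, out @ scan (link_code (m0 0) ?x ?y) (atom_code (m0 0) ?x) m1 (m1 14) n)"
    and m': "\<forall>r. r \<notin> {14, 15, 16, 5, 17, 18, 19} \<longrightarrow> m' r = m1 r"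
    by blast
  have "scan (link_code (m0 0) ?x ?y) (atom_code (m0 0) ?x) m1 (m1 14) n =
      scan (link_code (m0 0) ?x ?y) (atom_code (m0 0) ?x) m0 20 n"
    using scan_cong[of m1 20, OF eq] by (simp add: m1_def)
  then have "runs print_row (m, inp, out) (73 * n + 8)
      (m', inp, out @ scan (link_code (m0 0) ?x ?y) (atom_code (m0 0) ?x) m0 20 n)"
    using runs_mono[OF runs_seq[OF 1 2], of "73 * n + 8"] by (simp add: print_row_def)
  moreover have "m' r = m r" if "r \<notin> {5, 11, 12, 13, 14, 15, 16, 17, 18, 19}" for r
    using that m' by (simp add: m1_def)
  ultimately show ?thesis
    by blast
qed

text \<open>The outer scan charges a linear bound to each position, which gives the leading term
  \<open>146 * n ^ 2\<close>; the constant \<open>200\<close> leaves room for the reading phase and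
  the rest.\<close>

lemma runs_Xi_code:
  fixes p
  defines "ts \<equiv> encode p" and "s \<equiv> sum_list (encode p)"
  shows "\<exists>m. runs Xi_code (\<lambda>_. 0, ts, []) (200 * (length ts + 1) ^ 2)
    (m, [], encode (foldr Conj (conjuncts s p) (DiffEq (s - 8) (s - 8) (s - 8))))"
proof -
  let ?n = "length ts"
  define m1 :: "nat \<Rightarrow> nat" where
    "m1 = (\<lambda>_. 0)(1 := 1, 2 := 2, 3 := 3, 4 := 4, 6 := 6, 7 := 7, 8 := 20, 9 := hd (ts @ [0]))"
  have 1: "runs (block [Const 1 1, Const 2 2, Const 3 3, Const 4 4, Const 6 6, Const 7 7,
      Const 8 20, Read 9]) (\<lambda>_. 0, ts, []) 8 (m1, tl ts, [])"
    by (intro runs_block) (auto simp: m1_def fun_eq_iff split: list.split)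
  have ts0: "0 \<notin> set ts"
    unfolding ts_def by (rule zero_notin_encode)
  obtain m2 where 2: "runs read_loop (m1, tl ts, []) (6 * ?n + 1) (m2, [], [])"
    and s: "m2 0 = s" and st: "stored m2 20 ts"
    and eq: "\<And>r. r \<notin> {0, 8, 9} \<and> (r < 20 \<or> 20 + ?n \<le> r) \<Longrightarrow> m2 r = m1 r"
    using runs_read_loop[OF ts0, of m1 "[]"] by (auto simp: m1_def s_def ts_def)
  define m3 where "m3 = m2(8 := 20)"
  have 3: "runs (block [Const 8 20]) (m2, [], []) 1 (m3, [], [])"
    by (intro runs_block) (auto simp: m3_def)
  have cst: "m3 1 = 1" "m3 2 = 2" "m3 3 = 3" "m3 4 = 4" "m3 6 = 6" "m3 7 = 7" "m3 0 = s" "m3 8 = 20"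
    by (simp_all add: m3_def eq s m1_def)
  have nz: "m3 (20 + i) \<noteq> 0" if "i < ?n" for i
    using stored_nth[OF st that] ts0 that by (auto simp: m3_def in_set_conv_nth)
  have z: "m3 (20 + ?n) = 0"
    using eq[of "20 + ?n"] by (simp add: m3_def m1_def)
  let ?R = "{5, 11, 12, 13, 14, 15, 16, 17, 18, 19} :: nat set"
  let ?F = "\<lambda>x y. scan (link_code s x y) (atom_code s x) m3 20 ?n"
  have "\<exists>m'. runs (scan_loop 8 9 10 print_row (block [])) (m3, [], [])
      ((2 * (73 * ?n + 8) + 11) * ?n + 2) (m', [], [] @ scan ?F (\<lambda>_. []) m3 (m3 8) ?n) \<and>
      (\<forall>r. r \<notin> {8, 9, 10} \<union> ?R \<longrightarrow> m' r = m3 r)"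
  proof (rule runs_scan_loop[where R = ?R])
    fix m :: "nat \<Rightarrow> nat" and out
    assume m: "\<forall>r. r \<notin> {8, 9, 10} \<union> ?R \<longrightarrow> m r = m3 r" "20 \<le> m 8"
    show "\<exists>m'. runs print_row (m, [], out) (73 * ?n + 8)
        (m', [], out @ ?F (m3 (m 8 + 1)) (m3 (m 8 + 2))) \<and> (\<forall>r. r \<notin> ?R \<longrightarrow> m' r = m r)"
      using runs_print_row[OF cst(1-6) nz z m, of "[]" out] cst(7) by simp
    have "runs (block []) (m, [], out) (73 * ?n + 8) (m, [], out @ [])"
      by (intro runs_block) auto
    then show "\<exists>m'. runs (block []) (m, [], out) (73 * ?n + 8) (m', [], out @ []) \<and>
        (\<forall>r. r \<notin> ?R \<longrightarrow> m' r = m r)"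
      by blast
  qed (use cst nz z in auto)
  then obtain m4 where 4: "runs (scan_loop 8 9 10 print_row (block [])) (m3, [], [])
      ((2 * (73 * ?n + 8) + 11) * ?n + 2) (m4, [], scan ?F (\<lambda>_. []) m3 20 ?n)"
    and m4: "\<forall>r. r \<notin> {8, 9, 10} \<union> ?R \<longrightarrow> m4 r = m3 r"
    using cst(8) by auto
  let ?out = "encode (foldr Conj (conjuncts s p) (DiffEq (s - 8) (s - 8) (s - 8)))"
  have s8: "s - 8 + 8 = s"
    using eight_le_sum_list_encode[of p] by (simp add: s_def)
  have link: "4 # encode (link_fm s x y x' y') = link_code s (x + 8) (y + 8) (x' + 8) (y' + 8)"
    for x y x' y'
    using s8 by (simp add: link_fm_def link_code_def)
  have atom: "4 # encode (atom_fm s x v) = atom_code s (x + 8) (v + 8)" for x v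
    using s8 by (simp add: atom_fm_def atom_code_def)
  have st3: "stored m3 20 (encode p)"
  proof -
    have "20 \<le> a \<Longrightarrow> stored m2 a us \<Longrightarrow> stored m3 a us" for a us
      by (induction us arbitrary: a) (auto simp: m3_def)
    then show ?thesis
      using st by (simp add: ts_def)
  qed
  have out: "scan ?F (\<lambda>_. []) m3 20 ?n @ [1, s, s, s] = ?out"
    unfolding encode_foldr_Conj conjuncts_def concat_map_collect
    using s8 by (simp add: ts_def scan_encode[OF st3] link atom)
  have 5: "runs (block (map Print [1, 0, 0, 0])) (m4, [], scan ?F (\<lambda>_. []) m3 20 ?n) 4 (m4, [], ?out)"
  proof (rule runs_block)
    show "run (map Print [1, 0, 0, 0]) (m4, [], scan ?F (\<lambda>_. []) m3 20 ?n) = (m4, [], ?out)"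
      unfolding run_print out[symmetric] using m4 cst by simp
  qed simp_all
  have "runs Xi_code (\<lambda>_. 0, ts, [])
      (8 + (6 * ?n + 1 + (1 + ((2 * (73 * ?n + 8) + 11) * ?n + 2 + 4)))) (m4, [], ?out)"
    unfolding Xi_code_def by (rule runs_seq 1 2 3 4 5)+
  then show ?thesis
    by (intro exI) (erule runs_mono, simp add: power2_eq_square algebra_simps)
qed

lemma computable_Xi: "computable_in_time_O (\<lambda>n. real n ^ 2) A B Xi"
  unfolding computable_in_time_O_def
proof (intro exI conjI ballI)
  show "(\<lambda>n. real (200 * (n + 1) ^ 2)) \<in> O(\<lambda>n. real n ^ 2)"
  \<comment> \<open>\<open>800 = 200 * 2 ^ 2\<close>, since \<open>n + 1 \<le> 2 * n\<close> for
    positive \<open>n\<close>.\<close>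
  proof (rule bigoI[where c = 800])
    have "real (200 * (n + 1) ^ 2) \<le> 800 * real n ^ 2" if "1 \<le> n" for n
    proof -
      have "(n + 1) ^ 2 \<le> (2 * n) ^ 2"
        using that by (intro power_mono) auto
      then have "200 * (n + 1) ^ 2 \<le> 800 * n ^ 2"
        by (simp add: power_mult_distrib)
      then show ?thesis
        by (metis of_nat_le_iff of_nat_mult of_nat_numeral of_nat_power)
    qed
    then show "\<forall>\<^sub>F n in sequentially. norm (real (200 * (n + 1) ^ 2)) \<le> 800 * norm (real n ^ 2)"
      unfolding eventually_sequentially by (intro exI[of _ 1]) simp
  qed
  show "ram_computes_within (Xi_code 0) (encode (Conj p q)) (encode (Xi p q))
      (200 * (fm_length (Conj p q) + 1) ^ 2)" for p q
    using runs_Xi_code[of "Conj p q"] ram_computes_within_if_runs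
    unfolding Xi_def fm_length_def Let_def by blast
qed

section \<open>Semantics of the formula\<close>

primrec sings :: "fm \<Rightarrow> (var \<times> var) set" where
  "sings (DiffEq x y z) = {}"
| "sings (SingEq x y) = {(x, y)}"
| "sings (Neg p) = sings p"
| "sings (Conj p q) = sings p \<union> sings q"
| "sings (Disj p q) = sings p \<union> sings q"
| "sings (Imp p q) = sings p \<union> sings q"
| "sings (Iff p q) = sings p \<union> sings q"

lemma set_collect:
  "set (collect f g p) = (\<Union>(x, y)\<in>sings p. set (f x y)) \<union> (\<Union>v\<in>vars p. set (g v))"
  by (induction p) auto

lemma sings_subset_vars: "sings p \<subseteq> vars p \<times> vars p"
  by (induction p) auto

lemma finite_vars: "finite (vars p)"
  by (induction p) auto

lemma sings_BST: "p \<in> BST \<Longrightarrow> sings p = {}"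
  by (induction rule: BST.induct) auto

lemma sat_singleton_conjs:
  "p \<in> singleton_conjs \<Longrightarrow> sat elts M p \<longleftrightarrow> (\<forall>(x, y)\<in>sings p. elts (M x) = {M y})"
  by (induction rule: singleton_conjs.induct) (simp_all add: ball_Un)

lemma sat_BST_cong:
  assumes "p \<in> BST" "vars p \<subseteq> V"
    and "\<And>x y z. x \<in> V \<Longrightarrow> y \<in> V \<Longrightarrow> z \<in> V \<Longrightarrow>
      elts (M' x) = elts (M' y) - elts (M' z) \<longleftrightarrow> elts (M x) = elts (M y) - elts (M z)"
  shows "sat elts M' p \<longleftrightarrow> sat elts M p"
  using assms(1,2) by (induction rule: BST.induct) (auto simp: assms(3))

lemma sat_cong: "(\<And>v. v \<in> vars p \<Longrightarrow> M v = M' v) \<Longrightarrow> sat elts M p \<longleftrightarrow> sat elts M' p"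
  by (induction p) auto

lemma sat_foldr_Conj:
  "sat elts M (foldr Conj ps q) \<longleftrightarrow> (\<forall>p\<in>set ps. sat elts M p) \<and> sat elts M q"
  by (induction ps) auto

lemma foldr_Conj_BST_plus:
  "set ps \<subseteq> BST_plus \<Longrightarrow> q \<in> BST_plus \<Longrightarrow> foldr Conj ps q \<in> BST_plus"
  by (induction ps) (auto intro: BST_plus.intros)

lemma Xi_BST_plus: "Xi \<phi> \<psi> \<in> BST_plus"
proof -
  have "link_fm s x y x' y' \<in> BST_plus" "atom_fm s x v \<in> BST_plus" for s x y x' y' v
    unfolding link_fm_def atom_fm_def by (intro BST_plus.intros)+
  then show ?thesis
    unfolding Xi_def Let_def conjuncts_def
    by (intro foldr_Conj_BST_plus) (auto simp: set_collect intro: BST_plus.intros)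
qed

text \<open>If \<open>s - 8\<close> is not empty, the innermost conjunct of \<open>Xi\<close> fails
  and both sides are false. Otherwise the difference atoms become inclusions and equalities.\<close>

lemma sat_Xi:
  fixes elts :: "'v \<Rightarrow> 'v set" and \<phi> \<psi> :: fm
  assumes "\<phi> \<in> BST"
  defines "s \<equiv> sum_list (encode (Conj \<phi> \<psi>))"
  shows "sat elts M (Xi \<phi> \<psi>) \<longleftrightarrow>
    elts (M (s - 8)) = {} \<and>
    (\<forall>(x, y)\<in>sings \<psi>.
      (\<forall>v\<in>vars \<phi> \<union> vars \<psi>. elts (M x) \<subseteq> elts (M v) \<longleftrightarrow> elts (M x) \<inter> elts (M v) \<noteq> {}) \<and>
      (\<forall>(x', y')\<in>sings \<psi>. (elts (M x) = elts (M x') \<longleftrightarrow> elts (M y) = elts (M y')) \<and>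
        (elts (M x) \<subseteq> elts (M y') \<longrightarrow> elts (M (y + s)) \<subset> elts (M (y' + s)))))"
proof (cases "elts (M (s - 8)) = {}")
  case True
  have atom: "sat elts M (atom_fm s x v) \<longleftrightarrow>
      (elts (M x) \<subseteq> elts (M v) \<longleftrightarrow> elts (M x) \<inter> elts (M v) \<noteq> {})" for x v
    using True by (auto simp: atom_fm_def)
  have link: "sat elts M (link_fm s x y x' y') \<longleftrightarrow>
      (elts (M x) = elts (M x') \<longleftrightarrow> elts (M y) = elts (M y')) \<and>
        (elts (M x) \<subseteq> elts (M y') \<longrightarrow> elts (M (y + s)) \<subset> elts (M (y' + s)))" for x y x' y'
    using True by (simp add: link_fm_def) blast
  have "sat elts M (Xi \<phi> \<psi>) \<longleftrightarrow> (\<forall>(x, y)\<in>sings \<psi>.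
      (\<forall>v\<in>vars \<phi> \<union> vars \<psi>. sat elts M (atom_fm s x v)) \<and>
      (\<forall>(x', y')\<in>sings \<psi>. sat elts M (link_fm s x y x' y')))"
    using True sings_BST[OF assms(1)]
    unfolding Xi_def Let_def sat_foldr_Conj conjuncts_def set_collect s_def[symmetric]
    by (simp add: ball_Un split_def) blast
  then show ?thesis
    unfolding atom link using True by simp
next
  case False
  then show ?thesis
    unfolding Xi_def Let_def sat_foldr_Conj s_def[symmetric] by auto
qed

section \<open>Soundness and completeness of the translation\<close>

context set_universe
begin

text \<open>The conjuncts of \<open>Xi\<close> are the hypotheses of
  \<open>ex_singleton_assignment\<close>, with the values of the variables \<open>y + s\<close> as
  \<open>Z y\<close>.\<close>

lemma satisfiable_if_satisfiable_Xi:
  assumes \<phi>: "\<phi> \<in> BST" and \<psi>: "\<psi> \<in> singleton_conjs"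
    and "satisfiable elts (Conj \<phi> (Xi \<phi> \<psi>))"
  shows "satisfiable elts (Conj \<phi> \<psi>)"
proof -
  define s where "s = sum_list (encode (Conj \<phi> \<psi>))"
  obtain M where M: "sat elts M \<phi>" and "sat elts M (Xi \<phi> \<psi>)"
    using assms(3) by (auto simp: satisfiable_def)
  note Xi = this(2)[unfolded sat_Xi[OF \<phi>], folded s_def]
  have *: "finite (vars \<phi> \<union> vars \<psi>)"
    "sings \<psi> \<subseteq> (vars \<phi> \<union> vars \<psi>) \<times> (vars \<phi> \<union> vars \<psi>)"
    using finite_vars sings_subset_vars[of \<psi>] by auto
  have atom: "elts (M x) \<subseteq> elts (M v) \<longleftrightarrow> elts (M x) \<inter> elts (M v) \<noteq> {}"
    if "(x, y) \<in> sings \<psi>" "v \<in> vars \<phi> \<union> vars \<psi>" for x y v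
    using bspec[OF conjunct2[OF Xi] that(1)] that(2) by simp
  have eq: "elts (M x) = elts (M x') \<longleftrightarrow> elts (M y) = elts (M y')"
    and rank: "elts (M x) \<subseteq> elts (M y') \<Longrightarrow> elts (M (y + s)) \<subset> elts (M (y' + s))"
    if "(x, y) \<in> sings \<psi>" "(x', y') \<in> sings \<psi>" for x y x' y'
    using bspec[OF conjunct2[OF bspec[OF conjunct2[OF Xi] that(1), unfolded prod.case]] that(2)]
    by auto
  show ?thesis
  proof (rule ex_singleton_assignment[OF * atom eq rank])
    fix M'
    assume diff: "\<And>x y z. x \<in> vars \<phi> \<union> vars \<psi> \<Longrightarrow> y \<in> vars \<phi> \<union> vars \<psi> \<Longrightarrow>
        z \<in> vars \<phi> \<union> vars \<psi> \<Longrightarrow>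
        elts (M' x) = elts (M' y) - elts (M' z) \<longleftrightarrow> elts (M x) = elts (M y) - elts (M z)"
      and sing: "\<And>x y. (x, y) \<in> sings \<psi> \<Longrightarrow> elts (M' x) = {M' y}"
    have "sat elts M' \<phi>"
      using M sat_BST_cong[where M' = M', OF \<phi> Un_upper1 diff] by simp
    moreover have "sat elts M' \<psi>"
      unfolding sat_singleton_conjs[OF \<psi>] using sing by auto
    ultimately show ?thesis
      by (auto simp: satisfiable_def)
  qed
qed

text \<open>
  The value of the auxiliary variable for \<open>y\<close> consists of those values of the variables under a
  singleton that lie in the transitive closure of \<open>y\<close>.
\<close>

lemma sat_ex_Xi:
  fixes M :: "var \<Rightarrow> 'v"
  assumes \<phi>: "\<phi> \<in> BST" and \<psi>: "\<psi> \<in> singleton_conjs" and M: "sat elts M (Conj \<phi> \<psi>)"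
  shows "sat_ex elts M (vars (Xi \<phi> \<psi>) - (vars \<phi> \<union> vars \<psi>)) (Xi \<phi> \<psi>)"
proof -
  define s where "s = sum_list (encode (Conj \<phi> \<psi>))"
  define Y where "Y = (\<lambda>(x, y). M y) ` sings \<psi>"
  define E where "E = {(x, y). x \<in> elts y}"
  \<comment> \<open>Below \<open>s - 8\<close> lie the variables of the input, \<open>s - 8\<close>
    has to be empty, and from \<open>s\<close> on \<open>v - s\<close> recovers the variable to
    which \<open>v\<close> is attached.\<close>
  define M' where "M' v = (if v < s - 8 then M v else if v < s then mk {}
    else mk {u \<in> Y. (u, M (v - s)) \<in> E\<^sup>+})" for v
  have sing: "elts (M x) = {M y}" if "(x, y) \<in> sings \<psi>" for x y
  proof -
    have "\<forall>(x, y)\<in>sings \<psi>. elts (M x) = {M y}"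
      using M sat_singleton_conjs[OF \<psi>, of elts M] by simp
    then show ?thesis
      using that by blast
  qed
  have "finite (sings \<psi>)"
    using sings_subset_vars finite_vars by (meson finite_SigmaI finite_subset)
  then have finY: "finite Y"
    by (simp add: Y_def)
  have acyc: "(u, u) \<notin> E\<^sup>+" for u
    using wf_acyclic[OF foundation] by (simp add: E_def acyclic_def)
  have V: "M' v = M v" if "v \<in> vars \<phi> \<union> vars \<psi>" for v
  proof -
    \<comment> \<open>The other summands of \<open>s\<close>, such as the \<open>4\<close> of the
      outer conjunction, make this strict, so \<open>v < s - 8\<close>.\<close>
    have "v + 8 \<le> sum_list (encode \<phi>) \<or> v + 8 \<le> sum_list (encode \<psi>)"
      using that var_less_sum_list_encode by blast
    then show ?thesis
      by (auto simp: M'_def s_def)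
  qed
  have "8 \<le> s"
    using eight_le_sum_list_encode by (simp only: s_def)
  then have e: "elts (M' (s - 8)) = {}"
    by (simp add: M'_def elts_mk_finite)
  have z: "elts (M' (y + s)) = {u \<in> Y. (u, M y) \<in> E\<^sup>+}" for y
  proof -
    have "\<not> y + s < s - 8"
      by linarith
    then show ?thesis
      using finY by (simp add: M'_def elts_mk_finite)
  qed
  have psub: "elts (M' (y + s)) \<subset> elts (M' (y' + s))"
    if "(x, y) \<in> sings \<psi>" "M y \<in> elts (M y')" for x y y'
  proof -
    have 1: "(M y, M y') \<in> E\<^sup>+"
      using that(2) by (auto simp: E_def)
    then have "{u \<in> Y. (u, M y) \<in> E\<^sup>+} \<subseteq> {u \<in> Y. (u, M y') \<in> E\<^sup>+}"
      by (auto intro: trancl_trans)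
    \<comment> \<open>\<open>M y\<close> witnesses strictness: it is below \<open>M y'\<close>, but
      by foundation not below itself.\<close>
    moreover have "M y \<in> Y"
      using that(1) by (force simp: Y_def)
    ultimately show ?thesis
      unfolding z using 1 acyc by blast
  qed
  have vs: "x \<in> vars \<phi> \<union> vars \<psi>" "y \<in> vars \<phi> \<union> vars \<psi>" if "(x, y) \<in> sings \<psi>" for x y
    using that sings_subset_vars by blast+
  have "sat elts M' (Xi \<phi> \<psi>)"
    unfolding sat_Xi[OF \<phi>] s_def[symmetric]
  proof (intro conjI ballI e, clarify, intro conjI ballI, goal_cases)
    \<comment> \<open>A singleton is included in a set iff it meets it.\<close>
    case (1 x y v)
    then show ?case
      using V vs sing by simp
  next
    case (2 x y w)
    obtain x' y' where w: "w = (x', y')" "(x', y') \<in> sings \<psi>"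
      using 2 by (cases w) auto
    show ?case
      using V[OF vs(1)[OF 2(1)]] V[OF vs(2)[OF 2(1)]] V[OF vs(1)[OF w(2)]] V[OF vs(2)[OF w(2)]]
        sing[OF 2(1)] sing[OF w(2)] psub[OF 2(1), of y'] extensionality w(1)
      by auto
  qed
  \<comment> \<open>\<open>M'\<close> may also differ from \<open>M\<close> at variables that do not
    occur in \<open>Xi \<phi> \<psi>\<close>; there the values of \<open>M\<close> are restored, as
    \<open>sat_ex\<close> demands.\<close>
  moreover define M'' where
    "M'' v = (if v \<in> vars (Xi \<phi> \<psi>) - (vars \<phi> \<union> vars \<psi>) then M' v else M v)" for v
  have "sat elts M'' (Xi \<phi> \<psi>) \<longleftrightarrow> sat elts M' (Xi \<phi> \<psi>)"
    by (rule sat_cong) (use V in \<open>auto simp: M''_def\<close>)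
  ultimately show ?thesis
    unfolding sat_ex_def by (intro exI[of _ M'']) (simp add: M''_def)
qed

end

theorem theorem2:
  fixes elts :: "'v \<Rightarrow> 'v set"
  assumes "set_universe elts"
  shows "\<exists>\<Xi> :: fm \<Rightarrow> fm \<Rightarrow> fm.
    (\<forall>\<phi>\<in>BST. \<forall>\<psi>\<in>singleton_conjs. \<Xi> \<phi> \<psi> \<in> BST_plus) \<and>
    computable_in_time_O (\<lambda>n. real n ^ 2) BST singleton_conjs \<Xi> \<and>
    (\<forall>\<phi>\<in>BST. \<forall>\<psi>\<in>singleton_conjs.
       satisfiable elts (Conj \<phi> (\<Xi> \<phi> \<psi>)) \<longrightarrow> satisfiable elts (Conj \<phi> \<psi>)) \<and>
    (\<forall>\<phi>\<in>BST. \<forall>\<psi>\<in>singleton_conjs. \<forall>M :: var \<Rightarrow> 'v.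
       sat elts M (Conj \<phi> \<psi>) \<longrightarrow>
       sat_ex elts M (vars (\<Xi> \<phi> \<psi>) - (vars \<phi> \<union> vars \<psi>)) (\<Xi> \<phi> \<psi>))"
proof -
  interpret set_universe elts
    by (rule assms)
  show ?thesis
    using Xi_BST_plus computable_Xi satisfiable_if_satisfiable_Xi sat_ex_Xi
    by (intro exI[of _ Xi]) blast
qed

end
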